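(* Let $d,m\ge 1$, let $A$ be the weighted arithmetic average operator associated with weights $\alpha_1,\dots,\alpha_m$ and points $x_1,\dots,x_m\in\mathbb{R}^d$, let $c\in(0,1)$, and let $g,h:\mathbb{R}^d\to\mathbb{R}$ satisfy $Ag\ge g$, $Ah=h$ and $0\vee g\le h$. Let $\mathcal{D}$ be the operator $f\mapsto (c\cdot Af)\vee g$ and let $Q$ be the set of functions defined in the context. Then for all $n\in\mathbb{N}_0$, $$\mathcal{D}^{n+1}(g\vee 0)\ \ge\ \mathcal{D}^{n}(g\vee 0)=:q_n .$$ Furthermore, the pointwise limit $$q:=\lim_{n\to\infty}\mathcal{D}^n(g\vee 0)=\sup_{n\in\mathbb{N}_0}\mathcal{D}^n(g\vee 0)$$ exists and belongs to $Q$, and $q$ is the smallest nonnegative fixed point of $\mathcal{D}$ (that is, $\mathcal{D}q=q$, $q\geq 0$, and every $p$ in the domain of $\mathcal{D}$ with $\mathcal{D}p=p$ satisfies $p\ge q$).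
   Context: The weights $\alpha_1,\dots,\alpha_m\in[0,1]$ satisfy $\sum_{k=1}^m\alpha_k=1$, and $x_1,\dots,x_m\in\mathbb{R}^d$. The weighted arithmetic average operator $A$ acts on functions $f:\mathbb{R}^d\to\mathbb{R}$ by $(Af)(y)=\sum_{k=1}^m\alpha_k f(y-x_k)$ for $y\in\mathbb{R}^d$. The function $g$ is measurable. The operator $\mathcal{D}$ is defined on the cone of nonnegative measurable functions $f:\mathbb{R}^d\to\mathbb{R}$ by $\mathcal{D}f=(c\cdot Af)\vee g$, where $\vee$ denotes the pointwise maximum; $\mathcal{D}^n$ is its $n$-fold iterate ($\mathcal{D}^0$ is the identity). All inequalities, suprema and limits of functions are pointwise. $Q$ denotes the set of nonnegative measurable functions $f:\mathbb{R}^d\to\mathbb{R}$ with $f\le h$ and $Af\ge f$. $\mathbb{N}_0=\{0,1,2,\dots\}$. *)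

theory Defs
  imports "HOL-Analysis.Analysis"
begin

definition avg_op ::
    "nat \<Rightarrow> (nat \<Rightarrow> real) \<Rightarrow> (nat \<Rightarrow> real ^ 'd) \<Rightarrow> (real ^ 'd \<Rightarrow> real) \<Rightarrow> real ^ 'd \<Rightarrow> real"
  where "avg_op m \<alpha> x f = (\<lambda>y. \<Sum>k = 1..m. \<alpha> k * f (y - x k))"

definition nonneg_measurable :: "(real ^ 'd \<Rightarrow> real) set"
  where "nonneg_measurable = {f. f \<in> borel_measurable borel \<and> (\<forall>y. 0 \<le> f y)}"

text \<open>The formula makes sense for every real function; the operator is meant on the cone
  \<^const>\<open>nonneg_measurable\<close>, so statements about its fixed points have to be
  restricted to that cone explicitly.\<close>

definition D_op ::
    "nat \<Rightarrow> (nat \<Rightarrow> real) \<Rightarrow> (nat \<Rightarrow> real ^ 'd) \<Rightarrow> real \<Rightarrow> (real ^ 'd \<Rightarrow> real)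
      \<Rightarrow> (real ^ 'd \<Rightarrow> real) \<Rightarrow> real ^ 'd \<Rightarrow> real"
  where "D_op m \<alpha> x c g f = (\<lambda>y. max (c * avg_op m \<alpha> x f y) (g y))"

definition Q_set ::
    "nat \<Rightarrow> (nat \<Rightarrow> real) \<Rightarrow> (nat \<Rightarrow> real ^ 'd) \<Rightarrow> (real ^ 'd \<Rightarrow> real) \<Rightarrow> (real ^ 'd \<Rightarrow> real) set"
  where "Q_set m \<alpha> x h = {f \<in> nonneg_measurable. f \<le> h \<and> f \<le> avg_op m \<alpha> x f}"

definition q_iter ::
    "nat \<Rightarrow> (nat \<Rightarrow> real) \<Rightarrow> (nat \<Rightarrow> real ^ 'd) \<Rightarrow> real \<Rightarrow> (real ^ 'd \<Rightarrow> real)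
      \<Rightarrow> nat \<Rightarrow> real ^ 'd \<Rightarrow> real"
  where "q_iter m \<alpha> x c g n = (D_op m \<alpha> x c g ^^ n) (\<lambda>y. max (g y) 0)"

end

theory Submission imports Defs begin

text \<open>The operator is monotone, its first step does not decrease \<open>g \<or> 0\<close>, and
  every nonnegative \<open>p \<ge> g\<close> with \<open>D p \<le> p\<close> bounds all iterates from above. Taking
  \<open>p = h\<close> gives convergence, taking \<open>p\<close> a fixed point gives minimality; the limit is a fixed
  point because averages are finite sums. Finally \<open>A q \<ge> q\<close> since both \<open>c A q\<close> and
  \<open>g \<le> A g\<close> lie below \<open>A q\<close>.\<close>

lemma avg_op_mono:
  assumes "\<forall>k\<in>{1..m}. 0 \<le> \<alpha> k" and "f \<le> f'"
  shows "avg_op m \<alpha> x f \<le> avg_op m \<alpha> x f'"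
  using assms by (auto simp: avg_op_def le_fun_def intro!: sum_mono mult_left_mono)

lemma avg_op_nonneg:
  assumes "\<forall>k\<in>{1..m}. 0 \<le> \<alpha> k" and "\<And>y. 0 \<le> f y"
  shows "0 \<le> avg_op m \<alpha> x f y"
  using assms by (auto simp: avg_op_def intro!: sum_nonneg)

lemma D_op_mono:
  assumes "\<forall>k\<in>{1..m}. 0 \<le> \<alpha> k" and "0 \<le> c" and "f \<le> f'"
  shows "D_op m \<alpha> x c g f \<le> D_op m \<alpha> x c g f'"
  using avg_op_mono[OF assms(1,3), where x = x] \<open>0 \<le> c\<close>
  by (auto simp: D_op_def le_fun_def intro!: max.coboundedI1 mult_left_mono)

lemma D_op_measurable [measurable]:
  assumes [measurable]: "f \<in> borel_measurable borel" "g \<in> borel_measurable borel"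
  shows "D_op m \<alpha> x c g f \<in> borel_measurable borel"
  unfolding D_op_def avg_op_def by measurable

text \<open>Pointwise limits pass through the operator because it evaluates its argument at finitely
  many points and combines the values by sums, scalings and a maximum, all continuous.\<close>

lemma D_op_tendsto:
  assumes "\<And>y. (\<lambda>n. F n y) \<longlonglongrightarrow> f y"
  shows "(\<lambda>n. D_op m \<alpha> x c g (F n) y) \<longlonglongrightarrow> D_op m \<alpha> x c g f y"
  unfolding D_op_def avg_op_def by (intro tendsto_intros assms)

lemma q_iter_0: "q_iter m \<alpha> x c g 0 = (\<lambda>y. max (g y) 0)"
  by (simp add: q_iter_def)

lemma q_iter_Suc: "q_iter m \<alpha> x c g (Suc n) = D_op m \<alpha> x c g (q_iter m \<alpha> x c g n)"
  by (simp add: q_iter_def)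

lemma q_iter_measurable:
  assumes [measurable]: "g \<in> borel_measurable borel"
  shows "q_iter m \<alpha> x c g n \<in> borel_measurable borel"
  by (induction n) (simp_all add: q_iter_0 q_iter_Suc D_op_measurable assms)

text \<open>Only the start uses signs: the first step lies above \<open>g\<close> by the maximum and
  above 0 because \<open>c\<close> and the average are nonnegative. Monotonicity propagates
  this.\<close>

lemma q_iter_Suc_ge:
  assumes "\<forall>k\<in>{1..m}. 0 \<le> \<alpha> k" and "0 \<le> c"
  shows "q_iter m \<alpha> x c g n \<le> q_iter m \<alpha> x c g (Suc n)"
proof (induction n)
  case 0
  have "0 \<le> c * avg_op m \<alpha> x (\<lambda>y. max (g y) 0) y" for y
    using assms by (intro mult_nonneg_nonneg avg_op_nonneg) auto
  then show ?case
    unfolding q_iter_Suc q_iter_0 by (auto simp: D_op_def le_fun_def max.coboundedI1)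
next
  case (Suc n)
  then show ?case
    unfolding q_iter_Suc[of _ _ _ _ _ n] q_iter_Suc[of _ _ _ _ _ "Suc n"]
    by (intro D_op_mono assms)
qed

text \<open>Asking only for a pre-fixed point \<open>p\<close> lets the bound apply to
  \<open>h\<close>, which need not be fixed by the operator.\<close>

lemma q_iter_le:
  assumes "\<forall>k\<in>{1..m}. 0 \<le> \<alpha> k" and "0 \<le> c"
    and "(\<lambda>y. max (g y) 0) \<le> p" and "D_op m \<alpha> x c g p \<le> p"
  shows "q_iter m \<alpha> x c g n \<le> p"
proof (induction n)
  case 0
  then show ?case using assms(3) by (simp add: q_iter_0)
next
  case (Suc n)
  then have "q_iter m \<alpha> x c g (Suc n) \<le> D_op m \<alpha> x c g p"
    unfolding q_iter_Suc by (intro D_op_mono assms(1,2))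
  then show ?case using assms(4) by (rule order_trans)
qed

theorem theorem1:
  fixes m :: nat and \<alpha> :: "nat \<Rightarrow> real" and x :: "nat \<Rightarrow> real ^ 'd"
    and c :: real and g h :: "real ^ 'd \<Rightarrow> real"
  assumes "1 \<le> m"
    and "\<And>k. k \<in> {1..m} \<Longrightarrow> \<alpha> k \<in> {0..1}"
    and "(\<Sum>k = 1..m. \<alpha> k) = 1"
    and "c \<in> {0<..<1}"
    and "g \<in> borel_measurable borel"
    and "g \<le> avg_op m \<alpha> x g"
    and "avg_op m \<alpha> x h = h"
    and "(\<lambda>y. max 0 (g y)) \<le> h"
  shows "(\<forall>n. q_iter m \<alpha> x c g n \<le> q_iter m \<alpha> x c g (n + 1)) \<and>
    (\<exists>q. (\<forall>y. (\<lambda>n. q_iter m \<alpha> x c g n y) \<longlonglongrightarrow> q y) \<and>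
         (\<forall>y. bdd_above (range (\<lambda>n. q_iter m \<alpha> x c g n y)) \<and>
              q y = (SUP n. q_iter m \<alpha> x c g n y)) \<and>
         q \<in> Q_set m \<alpha> x h \<and>
         D_op m \<alpha> x c g q = q \<and>
         (\<forall>y. 0 \<le> q y) \<and>
         (\<forall>p \<in> nonneg_measurable. D_op m \<alpha> x c g p = p \<longrightarrow> q \<le> p))"
proof -
  let ?A = "avg_op m \<alpha> x" and ?D = "D_op m \<alpha> x c g" and ?q = "q_iter m \<alpha> x c g"
  have \<alpha>: "\<forall>k\<in>{1..m}. 0 \<le> \<alpha> k"
    using assms(2) by simp
  have c: "0 \<le> c" "c \<le> 1"
    using assms(4) by auto
  have gh: "g y \<le> h y" and h0: "0 \<le> h y" for y
    using assms(8) by (auto simp: le_fun_def)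
  have incr: "?q n \<le> ?q (Suc n)" for n
    by (rule q_iter_Suc_ge[OF \<alpha> c(1)])
  have q_h: "?q n \<le> h" for n
  proof (rule q_iter_le[OF \<alpha> c(1)])
    show "(\<lambda>y. max (g y) 0) \<le> h"
      using gh h0 by (simp add: le_fun_def)
    \<comment> \<open>As \<open>h\<close> is its own average, \<open>?D h\<close> is the maximum of
      \<open>c * h\<close> and \<open>g\<close>.\<close>
    have "c * h y \<le> h y" for y
      using c h0[of y] by (simp add: mult_left_le_one_le)
    then show "?D h \<le> h"
      using gh by (simp add: D_op_def assms(7) le_fun_def)
  qed
  define q where "q y = (SUP n. ?q n y)" for y
  \<comment> \<open>The bound by \<open>h\<close> makes the real-valued \<open>SUP\<close> a genuine
    supremum.\<close>
  have bdd: "bdd_above (range (\<lambda>n. ?q n y))" for y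
    using q_h by (auto simp: le_fun_def intro!: bdd_aboveI2)
  have lim: "(\<lambda>n. ?q n y) \<longlonglongrightarrow> q y" for y
    unfolding q_def using incr
    by (intro LIMSEQ_incseq_SUP bdd incseq_SucI) (simp add: le_fun_def)
  have q_upper: "?q n y \<le> q y" for n y
    unfolding q_def by (rule cSUP_upper[OF UNIV_I bdd])
  have q_least: "q \<le> p" if "\<And>n. ?q n \<le> p" for p
    using that by (auto simp: q_def le_fun_def intro!: cSUP_least)
  have q0: "0 \<le> q y" for y
    using q_upper[of 0 y] by (simp add: q_iter_0)
  have meas: "q \<in> borel_measurable borel"
    by (rule borel_measurable_LIMSEQ_real[where u = ?q])
      (simp_all add: lim q_iter_measurable assms(5))
  have fixed: "?D q = q"
  proof
    fix y
    \<comment> \<open>The shifted sequence tends to \<open>?D q y\<close> by continuity and to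
      \<open>q y\<close> as a tail of the iterates.\<close>
    have "(\<lambda>n. ?q (Suc n) y) \<longlonglongrightarrow> ?D q y"
      unfolding q_iter_Suc by (rule D_op_tendsto[OF lim])
    then show "?D q y = q y"
      using LIMSEQ_Suc[OF lim] LIMSEQ_unique by blast
  qed
  have "q y \<le> ?A q y" for y
  proof -
    \<comment> \<open>Iterate 0 already dominates \<open>g\<close>, so \<open>g\<close> \<le>
      \<open>?A g\<close> \<le> \<open>?A q\<close>.\<close>
    have "g \<le> q"
      using q_upper[of 0] by (simp add: q_iter_0 le_fun_def)
    then have "g y \<le> ?A q y"
      using order_trans[OF assms(6) avg_op_mono[OF \<alpha>]] by (simp add: le_fun_def)
    moreover have "c * ?A q y \<le> ?A q y"
      using c avg_op_nonneg[of m \<alpha> q x y] \<alpha> q0 by (simp add: mult_left_le_one_le)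
    ultimately have "?D q y \<le> ?A q y"
      by (simp add: D_op_def)
    then show ?thesis by (simp add: fixed)
  qed
  then have Q: "q \<in> Q_set m \<alpha> x h"
    using meas q0 q_least[OF q_h] by (simp add: Q_set_def nonneg_measurable_def le_fun_def)
  have minimal: "q \<le> p" if "p \<in> nonneg_measurable" and p: "?D p = p" for p
  proof (intro q_least q_iter_le[OF \<alpha> c(1)])
    \<comment> \<open>A fixed point dominates \<open>g\<close> through the maximum; membership in
      the cone supplies the comparison with 0.\<close>
    have "g y \<le> ?D p y" for y
      by (simp add: D_op_def)
    then show "(\<lambda>y. max (g y) 0) \<le> p"
      using that(1) by (simp add: p nonneg_measurable_def le_fun_def)
  qed (simp_all add: p)
  show ?thesis
    using incr lim bdd q_def Q fixed q0 minimal
    by (intro conjI exI[of _ q]) auto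
qed

end
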